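(* Let $\epsilon>0$ and $\phi>3\epsilon$. In the distributed streaming model with $k\ge 2$ sites, any deterministic algorithm that continuously tracks the $\epsilon$-approximate $\phi$-heavy hitters must incur (in the worst case over input sequences of $n$ items) a total communication cost of $\Omega\!\left(\frac{k}{\epsilon}\log n\right)$.
   Context: Distributed streaming model: a sequence $A=(a_1,\dots,a_n)$ of items from the universe $U=\{1,\dots,u\}$ arrives over time; item $a_i$ arrives at time $t_i$ ($t_1<\dots<t_n$) at exactly one of $k$ sites $S_1,\dots,S_k$. Each site has a two-way communication channel with a designated coordinator $C$ (no direct site-to-site communication). A site may initiate communication (or change its local state) only upon the arrival of an item at it or in response to the coordinator; communication is instantaneous. $A(t)$ denotes the multiset of items arrived up to time $t$. Communication cost is measured in words of $\Theta(\log n)$ bits. For $x\in U$, $m_x(A)$ is the number of occurrences of $x$ in $A$. An $\epsilon$-approximate set of $\phi$-heavy hitters is a set containing every $x$ with $m_x(A)\ge \phi|A|$ and no $x$ with $m_x(A)<(\phi-\epsilon)|A|$; tracking means the coordinator holds such a set for $A(t)$ at every time $t$.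
   Formalization: The formal theorem assumes φ ≤ φ_max < 1 (the constant may depend on φ_max) and a universe of size u ≥ 1/φ; without these the claim fails, e.g. φ = 1 is trackable with O(k) words and u = 1 with none. *)

theory Defs
  imports Complex_Main "HOL-Library.Multiset"
begin

type_synonym item = nat
type_synonym site = nat
type_synonym msg = "bool list"

text \<open>
  A message of \<open>b\<close> bits costs \<open>\<lceil>b/w\<rceil>\<close> words of \<open>w\<close> bits, and at least one word: the mere fact that
  a message is sent already conveys information, so even an empty message is charged.
\<close>

definition msg_words :: "nat \<Rightarrow> msg \<Rightarrow> nat" where
  "msg_words w m = max 1 (nat \<lceil>real (length m) / real w\<rceil>)"

text \<open>
  The local state of a party is taken to be the history of everything it has observed, which is the
  most informative state a deterministic party can have. The history of a site is extended
  only by an arrival at this site or by a message from the coordinator, and that of the coordinator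
  only by communication. Arrival times enter only through the order of arrivals.
\<close>

datatype site_event = Arrival item | From_Coord msg

text \<open>
  \<open>Report j m\<close>: site \<open>j\<close>, having just received an item, sends \<open>m\<close> on its own initiative.
  \<open>Query j q r\<close>: the coordinator sends \<open>q\<close> to site \<open>j\<close>, which replies \<open>r\<close>, or stays silent
  if \<open>r = None\<close>. The history of the coordinator is thus a full transcript of the communication.
\<close>

datatype coord_event = Report site msg | Query site msg "msg option"

record protocol =
  site_msg :: "site \<Rightarrow> site_event list \<Rightarrow> msg option"
  coord_msg :: "coord_event list \<Rightarrow> (site \<times> msg) option"
  answer :: "coord_event list \<Rightarrow> item set"

type_synonym config = "(site \<Rightarrow> site_event list) \<times> coord_event list"

text \<open>
  The instantaneous exchange following a report. The coordinator contacts one site after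
  the other, each time taking the possible reply into account, until it has no further message to
  send. Several simultaneous messages are represented by sending them in sequence. An exchange that
  does not terminate, or that addresses a site outside \<open>{..<k}\<close>, has no resulting configuration.
\<close>

inductive exchange :: "protocol \<Rightarrow> nat \<Rightarrow> config \<Rightarrow> config \<Rightarrow> bool" for P k where
  stop: "coord_msg P H = None \<Longrightarrow> exchange P k (\<sigma>, H) (\<sigma>, H)"
| query: "coord_msg P H = Some (j, q) \<Longrightarrow> j < k \<Longrightarrow> h = \<sigma> j @ [From_Coord q] \<Longrightarrow>
    exchange P k (\<sigma>(j := h), H @ [Query j q (site_msg P j h)]) C \<Longrightarrow>
    exchange P k (\<sigma>, H) C"

inductive arrive :: "protocol \<Rightarrow> nat \<Rightarrow> item \<times> site \<Rightarrow> config \<Rightarrow> config \<Rightarrow> bool" for P k where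
  silent: "h = \<sigma> j @ [Arrival x] \<Longrightarrow> site_msg P j h = None \<Longrightarrow>
    arrive P k (x, j) (\<sigma>, H) (\<sigma>(j := h), H)"
| report: "h = \<sigma> j @ [Arrival x] \<Longrightarrow> site_msg P j h = Some m \<Longrightarrow>
    exchange P k (\<sigma>(j := h), H @ [Report j m]) C \<Longrightarrow>
    arrive P k (x, j) (\<sigma>, H) C"

inductive run :: "protocol \<Rightarrow> nat \<Rightarrow> (item \<times> site) list \<Rightarrow> config \<Rightarrow> bool" for P k where
  init: "run P k [] (\<lambda>_. [], [])"
| step: "run P k as C \<Longrightarrow> arrive P k a C C' \<Longrightarrow> run P k (as @ [a]) C'"

lemma exchange_deterministic:
  "exchange P k C C1 \<Longrightarrow> exchange P k C C2 \<Longrightarrow> C1 = C2"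
proof (induction arbitrary: C2 rule: exchange.induct)
  case (stop H \<sigma>)
  from stop(2,1) show ?case by cases auto
next
  case (query H j q h \<sigma> C)
  from query.prems query.hyps show ?case
    by cases (auto intro: query.IH)
qed

lemma arrive_deterministic:
  assumes "arrive P k a C C1" "arrive P k a C C2"
  shows "C1 = C2"
  using assms by (auto elim!: arrive.cases dest: exchange_deterministic)

lemma run_deterministic:
  "run P k as C1 \<Longrightarrow> run P k as C2 \<Longrightarrow> C1 = C2"
proof (induction arbitrary: C2 rule: run.induct)
  case init
  then show ?case by cases auto
next
  case (step as C a C')
  from step.prems obtain D where "run P k as D" "arrive P k a D C2"
    by cases auto
  with step.IH step.hyps show ?case by (metis arrive_deterministic)
qed

fun event_words :: "nat \<Rightarrow> coord_event \<Rightarrow> nat" where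
  "event_words w (Report j m) = msg_words w m"
| "event_words w (Query j q None) = msg_words w q"
| "event_words w (Query j q (Some r)) = msg_words w q + msg_words w r"

definition cost :: "nat \<Rightarrow> coord_event list \<Rightarrow> nat" where
  "cost w H = sum_list (map (event_words w) H)"

definition inputs :: "nat \<Rightarrow> nat \<Rightarrow> nat \<Rightarrow> (item \<times> site) list set" where
  "inputs k u n = {as. length as = n \<and> set as \<subseteq> {1..u} \<times> {..<k}}"

definition approx_heavy_hitters ::
    "item set \<Rightarrow> real \<Rightarrow> real \<Rightarrow> item multiset \<Rightarrow> item set \<Rightarrow> bool" where
  "approx_heavy_hitters U \<epsilon> \<phi> A S \<longleftrightarrow>
     (\<forall>x\<in>U. real (count A x) \<ge> \<phi> * real (size A) \<longrightarrow> x \<in> S) \<and>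
     (\<forall>x\<in>U. real (count A x) < (\<phi> - \<epsilon>) * real (size A) \<longrightarrow> x \<notin> S)"

text \<open>
  Correctness is required on the inputs of \<open>n\<close> items only, so that a protocol may be tailored to \<open>n\<close>;
  and only from the first arrival on, since for an empty multiset all thresholds degenerate to 0.
\<close>

definition tracks_heavy_hitters ::
    "protocol \<Rightarrow> nat \<Rightarrow> nat \<Rightarrow> real \<Rightarrow> real \<Rightarrow> nat \<Rightarrow> bool" where
  "tracks_heavy_hitters P k u \<epsilon> \<phi> n \<longleftrightarrow>
     (\<forall>as\<in>inputs k u n. \<forall>i\<in>{1..n}. \<exists>\<sigma> H.
        run P k (take i as) (\<sigma>, H) \<and>
        approx_heavy_hitters {1..u} \<epsilon> \<phi> (mset (map fst (take i as))) (answer P H))"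

end

theory Submission
  imports Defs
begin

text \<open>
  Suppose an item is currently light, but becomes heavy once each of the \<open>k\<close> sites has received
  \<open>e\<close> further copies of it. Then some site must communicate when it alone receives \<open>e\<close> copies:
  otherwise all sites could receive theirs in silence, and the coordinator would never learn of the
  change. An adversary can repeat this as long as the item remains light, which forces \<open>\<Omega>(k)\<close>
  messages for each item that rises from a fraction \<open>\<phi> - 2\<epsilon>\<close> towards \<open>\<phi>\<close>. The adversary raises
  \<open>L\<close> items, where \<open>L\<close> is of order \<open>1/\<phi>\<close>, then adds copies of a filler item until all of them have
  dropped to a fraction \<open>\<phi> - 2\<epsilon>\<close> again, and starts over. In one such cycle the number of fillers,
  which remains a constant fraction of the input, grows by a factor \<open>1 + O(\<epsilon>/\<phi>)\<close> only, so that
  there is room for \<open>\<Omega>((\<phi>/\<epsilon>) log n)\<close> cycles, each costing \<open>\<Omega>(k/\<phi>)\<close> messages.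
\<close>

section \<open>Growth of the transcript and silent arrivals\<close>

lemma exchange_length_mono:
  "exchange P k C C' \<Longrightarrow> length (snd C) \<le> length (snd C')"
  by (induction rule: exchange.induct) auto

lemma arrive_length_mono:
  "arrive P k a C C' \<Longrightarrow> length (snd C) \<le> length (snd C')"
  by (auto elim!: arrive.cases dest!: exchange_length_mono)

lemma run_appendD:
  assumes "run P k (s @ t) C'"
  shows "\<exists>C. run P k s C \<and> length (snd C) \<le> length (snd C')"
  using assms
proof (induction t arbitrary: C' rule: rev_induct)
  case Nil
  then show ?case by (intro exI[of _ C']) simp
next
  case (snoc a t)
  from snoc.prems obtain D where D: "run P k (s @ t) D" "arrive P k a D C'"
    by cases auto
  from snoc.IH[OF D(1)] arrive_length_mono[OF D(2)] show ?case
    using order_trans by blast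
qed

text \<open>The length of the transcript detects communication: a report adds an entry and no entry
  is ever removed. If the length has not grown, each of the \<open>e\<close> arrivals was silent, so
  that only the history of site \<open>j\<close> has changed.\<close>

lemma run_replicate:
  assumes "run P k s (\<sigma>, H)" and "run P k (s @ replicate e (x, j)) C"
  shows "length (snd C) > length H \<or> C = (\<sigma>(j := \<sigma> j @ replicate e (Arrival x)), H) \<and>
    (\<forall>i\<in>{1..e}. site_msg P j (\<sigma> j @ replicate i (Arrival x)) = None)"
  using assms(2)
proof (induction e arbitrary: C)
  case 0
  then have "run P k s C" by simp
  then have "C = (\<sigma>, H)" using assms(1) by (rule run_deterministic)
  then show ?case by simp
next
  case (Suc e)
  have eq: "s @ replicate (Suc e) (x, j) = (s @ replicate e (x, j)) @ [(x, j)]"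
    by (simp add: replicate_append_same)
  from Suc.prems[unfolded eq] obtain D
    where D: "run P k (s @ replicate e (x, j)) D" "arrive P k (x, j) D C"
    by cases auto
  from Suc.IH[OF D(1)] show ?case
  proof
    assume "length (snd D) > length H"
    with arrive_length_mono[OF D(2)] show ?thesis by simp
  next
    assume *: "D = (\<sigma>(j := \<sigma> j @ replicate e (Arrival x)), H) \<and>
      (\<forall>i\<in>{1..e}. site_msg P j (\<sigma> j @ replicate i (Arrival x)) = None)"
    from D(2) show ?thesis
    proof cases
      case (silent h \<sigma>' H')
      have \<sigma>': "\<sigma>' = \<sigma>(j := \<sigma> j @ replicate e (Arrival x))" using silent * by simp
      have "site_msg P j (\<sigma>' j @ [Arrival x]) = None" using silent by simp
      then have last: "site_msg P j (\<sigma> j @ replicate (Suc e) (Arrival x)) = None"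
        by (simp add: \<sigma>' replicate_append_same)
      have "site_msg P j (\<sigma> j @ replicate i (Arrival x)) = None" if "i \<in> {1..Suc e}" for i
      proof (cases "i = Suc e")
        case True
        with last show ?thesis by simp
      next
        case False
        with * that show ?thesis by simp
      qed
      moreover have "C = (\<sigma>(j := \<sigma> j @ replicate (Suc e) (Arrival x)), H)"
        using silent * by (simp add: \<sigma>' replicate_append_same)
      ultimately show ?thesis by blast
    next
      case (report h \<sigma>' m H')
      from exchange_length_mono[OF report(4)] report(1) * show ?thesis by simp
    qed
  qed
qed

lemma run_silent:
  assumes "run P k s (\<sigma>, H)"
    and "\<forall>i\<in>{1..e}. site_msg P j (\<sigma> j @ replicate i (Arrival x)) = None"
  shows "run P k (s @ replicate e (x, j)) (\<sigma>(j := \<sigma> j @ replicate e (Arrival x)), H)"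
  using assms(2)
proof (induction e)
  case 0
  with assms(1) show ?case by simp
next
  case (Suc e)
  let ?h = "\<sigma> j @ replicate (Suc e) (Arrival x)"
  have "arrive P k (x, j) (\<sigma>(j := \<sigma> j @ replicate e (Arrival x)), H)
      ((\<sigma>(j := \<sigma> j @ replicate e (Arrival x)))(j := ?h), H)"
    using bspec[OF Suc.prems, of "Suc e"] by (intro arrive.silent) (auto simp: replicate_append_same)
  moreover have "run P k (s @ replicate e (x, j)) (\<sigma>(j := \<sigma> j @ replicate e (Arrival x)), H)"
    using Suc.prems by (intro Suc.IH) simp
  ultimately have "run P k ((s @ replicate e (x, j)) @ [(x, j)]) (\<sigma>(j := ?h), H)"
    using run.step by fastforce
  then show ?case by (simp add: replicate_append_same fun_upd_def)
qed

text \<open>Whether a site reports depends on its own history alone. Sites that would each stay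
  silent when tested separately from the same configuration therefore also stay silent one after the
  other. That the sites from \<open>l\<close> on keep their histories is what carries the
  induction.\<close>

lemma run_silent_sites:
  assumes "run P k s (\<sigma>, H)"
    and "\<forall>j<l. \<forall>i\<in>{1..e}. site_msg P j (\<sigma> j @ replicate i (Arrival x)) = None"
  shows "\<exists>\<sigma>'. run P k (s @ concat (map (\<lambda>j. replicate e (x, j)) [0..<l])) (\<sigma>', H) \<and>
    (\<forall>j\<ge>l. \<sigma>' j = \<sigma> j)"
  using assms(2)
proof (induction l)
  case 0
  with assms(1) show ?case by auto
next
  case (Suc l)
  then obtain \<sigma>' where \<sigma>':
    "run P k (s @ concat (map (\<lambda>j. replicate e (x, j)) [0..<l])) (\<sigma>', H)"
    "\<forall>j\<ge>l. \<sigma>' j = \<sigma> j"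
    by auto
  with Suc.prems have "\<forall>i\<in>{1..e}. site_msg P l (\<sigma>' l @ replicate i (Arrival x)) = None"
    by simp
  from run_silent[OF \<sigma>'(1) this] \<sigma>'(2) show ?case
    by (intro exI[of _ "\<sigma>'(l := \<sigma>' l @ replicate e (Arrival x))"] conjI) (simp_all add: fun_upd_def)
qed

text \<open>Each transcript entry is charged at least one word, whatever the word size. The lower
  bound can thus be proved by counting entries.\<close>

lemma length_le_cost: "length H \<le> cost w H"
proof (induction H)
  case (Cons h H)
  have "event_words w h \<ge> 1"
    by (cases "(w, h)" rule: event_words.cases) (auto simp: msg_words_def)
  with Cons show ?case by (simp add: cost_def)
qed (simp add: cost_def)

abbreviation occurrences :: "item \<Rightarrow> (item \<times> site) list \<Rightarrow> nat" where
  "occurrences x s \<equiv> count (image_mset fst (mset s)) x"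

lemma occurrences_eq_length: "set t \<subseteq> {x} \<times> S \<Longrightarrow> occurrences x t = length t"
  by (induction t) auto

lemma occurrences_le_length: "occurrences x t \<le> length t"
  using count_le_size[of "image_mset fst (mset t)" x] by simp

lemma occurrences_eq_0: "x \<notin> fst ` set t \<Longrightarrow> occurrences x t = 0"
  by (simp add: count_eq_zero_iff)

section \<open>The setting of the adversary\<close>

text \<open>The items 1 to \<open>L\<close> are the ones to be raised, and \<open>Suc L\<close> is
  the filler, which lies in the universe because \<open>L < u\<close>. The parameter \<delta> keeps
  \<phi> away from 1, and it is the share of the input left to the fillers when all \<open>L\<close>
  items have reached the fraction \<phi>.\<close>

locale heavy_hitter_tracker =
  fixes P :: protocol and k u n L :: nat and \<epsilon> \<phi> \<delta> :: real
  assumes tracks: "tracks_heavy_hitters P k u \<epsilon> \<phi> n"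
    and k: "k \<ge> 2" and \<epsilon>: "\<epsilon> > 0" "\<phi> > 3 * \<epsilon>"
    and \<delta>: "\<delta> > 0" "\<delta> \<le> 1/2" "\<phi> \<le> 1 - \<delta>" "\<phi> * real L \<le> 1 - \<delta>"
    and L: "L < u"
begin

text \<open>Tracking is assumed on inputs of exactly \<open>n\<close> items only. The adversary's
  sequences are those that padding can turn into such an input, so that the algorithm must be
  correct on them as well.\<close>

definition prefixes :: "(item \<times> site) list set" where
  "prefixes = {s. set s \<subseteq> {1..u} \<times> {..<k} \<and> length s \<le> n}"

text \<open>Runs are deterministic, so the description is proper as soon as a run exists, which
  \<open>run_conf\<close> shows for all of \<open>prefixes\<close>.\<close>

definition conf :: "(item \<times> site) list \<Rightarrow> config" where
  "conf s = (THE C. run P k s C)"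

definition msgs :: "(item \<times> site) list \<Rightarrow> nat" where
  "msgs s = length (snd (conf s))"

lemma conf_eq: "run P k s C \<Longrightarrow> conf s = C"
  unfolding conf_def using run_deterministic by blast

lemma pad_in_inputs:
  assumes "s \<in> prefixes"
  shows "s @ replicate (n - length s) (u, 0) \<in> inputs k u n"
  using assms k L by (auto simp: prefixes_def inputs_def)

lemma run_conf_and_answer:
  assumes "s \<in> prefixes" "s \<noteq> []"
  shows "run P k s (conf s) \<and>
    approx_heavy_hitters {1..u} \<epsilon> \<phi> (mset (map fst s)) (answer P (snd (conf s)))"
proof -
  let ?as = "s @ replicate (n - length s) (u, 0)"
  have "length s \<in> {1..n}" "take (length s) ?as = s"
    using assms by (auto simp: prefixes_def Suc_le_eq)
  with tracks pad_in_inputs[OF assms(1)] obtain \<sigma> H where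
    "run P k s (\<sigma>, H)" "approx_heavy_hitters {1..u} \<epsilon> \<phi> (mset (map fst s)) (answer P H)"
    unfolding tracks_heavy_hitters_def by metis
  moreover from this(1) have "conf s = (\<sigma>, H)" by (rule conf_eq)
  ultimately show ?thesis by simp
qed

lemma run_conf: "s \<in> prefixes \<Longrightarrow> run P k s (conf s)"
  using run_conf_and_answer[of s] conf_eq[OF run.init] run.init by (cases "s = []") auto

lemma msgs_mono: "s @ t \<in> prefixes \<Longrightarrow> msgs s \<le> msgs (s @ t)"
  by (metis run_appendD run_conf conf_eq msgs_def)

section \<open>Messages forced by raising a single item\<close>

text \<open>The adversary will play only \<open>e\<close> copies, at the site found here.
  Nevertheless all \<open>k * e\<close> copies must fit into the input, since the contradiction
  comes from the continuation in which every site receives its share.\<close>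

lemma forced_message:
  assumes s: "s \<in> prefixes" and x: "x \<in> {1..u}" and room: "length s + k * e \<le> n"
    and light: "real (occurrences x s) < (\<phi> - \<epsilon>) * real (length s)"
    and heavy: "real (occurrences x s + k * e) \<ge> \<phi> * real (length s + k * e)"
  shows "\<exists>j<k. msgs (s @ replicate e (x, j)) > msgs s"
proof (rule ccontr)
  assume contr: "\<not> ?thesis"
  obtain \<sigma> H where C: "conf s = (\<sigma>, H)" by fastforce
  with run_conf[OF s] have run: "run P k s (\<sigma>, H)" by simp
  have "s \<noteq> []" using light by auto
  have silent: "\<forall>i\<in>{1..e}. site_msg P j (\<sigma> j @ replicate i (Arrival x)) = None" if "j < k" for j
  proof -
    have "e \<le> k * e" using k by simp
    with room have "length s + e \<le> n" by linarith
    then have "s @ replicate e (x, j) \<in> prefixes"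
      using s x room that by (auto simp: prefixes_def)
    from run_replicate[OF run run_conf[OF this]] show ?thesis
      using contr that by (auto simp: msgs_def C)
  qed
  define t where "t = concat (map (\<lambda>j. replicate e (x, j)) [0..<k])"
  obtain \<sigma>' where run': "run P k (s @ t) (\<sigma>', H)"
    using run_silent_sites[OF run, of k e x] silent unfolding t_def by blast
  have len: "length t = k * e"
    by (simp add: t_def length_concat comp_def sum_list_triv)
  have t: "set t \<subseteq> {x} \<times> {..<k}"
    by (auto simp: t_def)
  have occ: "occurrences x t = k * e"
    using occurrences_eq_length[OF t] len by simp
  have pre: "s @ t \<in> prefixes"
    using s x t room len by (auto simp: prefixes_def)
  \<comment> \<open>The transcript \<open>H\<close> is the same before and after \<open>t\<close>,
    so one and the same answer would have to contain \<open>x\<close> and omit it.\<close>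
  have "x \<in> answer P H"
    using run_conf_and_answer[OF pre] conf_eq[OF run'] \<open>s \<noteq> []\<close> x heavy occ len
    by (auto simp: approx_heavy_hitters_def)
  moreover have "x \<notin> answer P H"
    using run_conf_and_answer[OF s \<open>s \<noteq> []\<close>] C x light
    by (auto simp: approx_heavy_hitters_def)
  ultimately show False by simp
qed

text \<open>It suffices to check lightness after \<open>q\<close> rounds and heaviness before the
  first one. A copy of \<open>x\<close> raises the count by 1 and the thresholds by only \<phi> -
  \<epsilon> and \<phi>: lightness after \<open>q\<close> rounds implies lightness after fewer, and
  heaviness persists. The argument applies after each of 0 to \<open>q\<close> rounds, which gives
  \<open>Suc q\<close> messages.\<close>

lemma forced_messages:
  assumes s: "s \<in> prefixes" and x: "x \<in> {1..u}" and room: "length s + q * e + k * e \<le> n"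
    and light: "real (occurrences x s + q * e) < (\<phi> - \<epsilon>) * real (length s + q * e)"
    and heavy: "real (occurrences x s + k * e) \<ge> \<phi> * real (length s + k * e)"
    and "i \<le> Suc q"
  shows "\<exists>t. set t \<subseteq> {x} \<times> {..<k} \<and> length t = i * e \<and> msgs (s @ t) \<ge> msgs s + i"
  using \<open>i \<le> Suc q\<close>
proof (induction i)
  case 0
  show ?case by (intro exI[of _ "[]"]) auto
next
  case (Suc i)
  then obtain t where t: "set t \<subseteq> {x} \<times> {..<k}" "length t = i * e" "msgs (s @ t) \<ge> msgs s + i"
    by auto
  have ie: "i * e \<le> q * e" using Suc.prems by simp
  with room have len: "length s + i * e + k * e \<le> n" by linarith
  have occ: "occurrences x t = i * e"
    using occurrences_eq_length[OF t(1)] t(2) by simp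
  have pre: "s @ t \<in> prefixes"
    using s x t len by (auto simp: prefixes_def)
  have "(1 - (\<phi> - \<epsilon>)) * real (i * e) \<le> (1 - (\<phi> - \<epsilon>)) * real (q * e)"
    using \<epsilon> \<delta> by (intro mult_left_mono of_nat_mono ie) simp
  then have light': "real (occurrences x (s @ t)) < (\<phi> - \<epsilon>) * real (length (s @ t))"
    using light by (simp add: occ t(2) algebra_simps)
  have "0 \<le> (1 - \<phi>) * real (i * e)" using \<delta> by (intro mult_nonneg_nonneg) auto
  then have heavy': "real (occurrences x (s @ t) + k * e) \<ge> \<phi> * real (length (s @ t) + k * e)"
    using heavy by (simp add: occ t(2) algebra_simps)
  have "length (s @ t) + k * e \<le> n"
    using len t(2) by simp
  from forced_message[OF pre x this light' heavy'] obtain j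
    where "j < k" "msgs (s @ t @ replicate e (x, j)) > msgs (s @ t)" by auto
  with t show ?case
    by (intro exI[of _ "t @ replicate e (x, j)"]) auto
qed

lemma raise_item:
  assumes s: "s \<in> prefixes" and x: "x \<in> {1..u}" and room: "3 * real (length s) / \<delta> \<le> real n"
    and large: "\<epsilon> * real (length s) \<ge> real k"
    and low: "real (occurrences x s) \<le> (\<phi> - 2 * \<epsilon>) * real (length s)"
  shows "\<exists>t. set t \<subseteq> {x} \<times> {..<k} \<and> s @ t \<in> prefixes \<and>
    real (msgs (s @ t)) \<ge> real (msgs s) + \<delta> * real k / 8 \<and>
    real (occurrences x (s @ t)) \<le> \<phi> * real (length (s @ t)) + real k"
proof -
  define m c where "m = real (length s)" and "c = real (occurrences x s)"
  \<comment> \<open>The least \<open>e\<close> for which \<open>k * e\<close> further copies make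
    \<open>x\<close> heavy, obtained by solving c + ke \<ge> \<phi>(m + ke).\<close>
  define e where "e = nat \<lceil>(\<phi> * m - c) / ((1 - \<phi>) * real k)\<rceil>"
  \<comment> \<open>As 1 - \<phi> \<ge> \<delta>, \<open>q\<close> rounds take at most an eighth of
    \<phi>m - c + k copies. Lightness leaves room for \<phi>m - c - \<epsilon>m, which is at least
    half of \<phi>m - c, and k \<le> \<epsilon>m makes up for the rounding of \<open>e\<close>. The
    extra round in \<open>Suc q\<close> offsets the rounding of \<open>q\<close>.\<close>
  define q where "q = nat \<lfloor>\<delta> * real k / 8\<rfloor>"
  define D where "D = real k * real e"
  have kr: "real k \<ge> 2" using k by simp
  have \<phi>: "0 < \<phi>" "0 < 1 - \<phi>" using \<epsilon> \<delta> by auto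
  have \<Delta>: "\<phi> * m - c \<ge> 2 * (\<epsilon> * m)" "\<epsilon> * m \<ge> real k" "c \<ge> 0" "m \<ge> 0"
    using low large by (simp_all add: m_def c_def algebra_simps)
  define y where "y = (\<phi> * m - c) / ((1 - \<phi>) * real k)"
  have y0: "y \<ge> 0" using \<Delta> \<phi> kr unfolding y_def by (intro divide_nonneg_pos mult_pos_pos) auto
  have e: "real e \<ge> y" "real e \<le> y + 1"
    using y0 unfolding e_def y_def[symmetric] by linarith+
  have yk: "(1 - \<phi>) * (real k * y) = \<phi> * m - c"
    using \<phi> kr by (simp add: y_def)
  have D1: "(1 - \<phi>) * D \<ge> \<phi> * m - c"
    unfolding D_def yk[symmetric] using \<phi> e by (intro mult_left_mono) auto
  have "(1 - \<phi>) * D \<le> (1 - \<phi>) * (real k * (y + 1))"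
    unfolding D_def using \<phi> e by (intro mult_left_mono) auto
  also have "\<dots> = \<phi> * m - c + (1 - \<phi>) * real k"
    by (simp add: yk[symmetric] algebra_simps)
  finally have D2: "(1 - \<phi>) * D \<le> \<phi> * m - c + (1 - \<phi>) * real k" .
  have "(1 - \<phi>) * real k \<le> 1 * real k" using \<phi> by (intro mult_right_mono) auto
  with D2 have D3: "(1 - \<phi>) * D \<le> \<phi> * m - c + real k" by simp
  have D0: "D \<ge> 0" by (simp add: D_def)
  have \<delta>D: "\<delta> * D \<le> \<phi> * m - c + real k"
    using D3 mult_right_mono[of \<delta> "1 - \<phi>" D] \<delta> D0 by linarith
  have q: "real q \<le> \<delta> * real k / 8" "real q + 1 \<ge> \<delta> * real k / 8"
    using mult_nonneg_nonneg[of \<delta> "real k"] \<delta> unfolding q_def by linarith+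
  have "\<delta> * real k \<le> 1/2 * real k" using \<delta> by (intro mult_right_mono) auto
  then have qk: "real q + 1 \<le> real k" using q kr by linarith
  have "real q * real e \<le> \<delta> * real k / 8 * real e" using q by (intro mult_right_mono) auto
  also have "\<dots> = \<delta> * D / 8" by (simp add: D_def)
  finally have qe: "8 * (real q * real e) \<le> \<phi> * m - c + real k" using \<delta>D by simp
  have light: "real (occurrences x s + q * e) < (\<phi> - \<epsilon>) * real (length s + q * e)"
  proof -
    have "(1 - \<phi> + \<epsilon>) * (real q * real e) \<le> 1 * (real q * real e)"
      using \<epsilon> by (intro mult_right_mono) auto
    also have "\<dots> < \<phi> * m - c - \<epsilon> * m" using qe \<Delta> kr by linarith
    finally show ?thesis by (simp add: m_def c_def algebra_simps)
  qed
  have heavy: "real (occurrences x s + k * e) \<ge> \<phi> * real (length s + k * e)"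
    using D1 by (simp add: D_def m_def c_def algebra_simps)
  have km: "real k \<le> m / 3"
    using \<Delta> \<epsilon> \<phi> mult_right_mono[of "\<epsilon>" "1/3" m] by simp
  have qD: "(real q + 1) * real e \<le> D"
    unfolding D_def using qk by (intro mult_right_mono) auto
  \<comment> \<open>The \<open>q\<close> rounds played and the hypothetical continuation by
    \<open>k * e\<close> copies take at most \<open>D\<close> copies each.\<close>
  have room': "m + 2 * D \<le> real n"
  proof -
    have "\<phi> * m \<le> (1 - \<delta>) * m" using \<delta> \<Delta> by (intro mult_right_mono) auto
    then have "\<delta> * D \<le> (1 - \<delta>) * m + m / 3" using \<delta>D \<Delta> km by linarith
    moreover have "\<delta> * (m + 2 * D) = \<delta> * m + 2 * (\<delta> * D)" by (simp add: algebra_simps)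
    moreover have "0 \<le> \<delta> * m" using \<delta> \<Delta> by simp
    ultimately have "\<delta> * (m + 2 * D) \<le> 3 * m" using \<Delta> by (simp add: algebra_simps)
    then have "m + 2 * D \<le> 3 * m / \<delta>" using \<delta> by (simp add: field_simps)
    with room show ?thesis by (simp add: m_def)
  qed
  have "real (length s + q * e + k * e) \<le> m + 2 * D"
    using qD by (simp add: m_def D_def algebra_simps)
  with room' have "length s + q * e + k * e \<le> n" by linarith
  from forced_messages[OF s x this light heavy order.refl] obtain t where
    t: "set t \<subseteq> {x} \<times> {..<k}" "length t = Suc q * e" "msgs (s @ t) \<ge> msgs s + Suc q"
    by blast
  have occ: "occurrences x t = length t"
    using occurrences_eq_length[OF t(1)] t(2) by simp
  have lt: "real (length t) = (real q + 1) * real e" by (simp add: t(2) algebra_simps)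
  have "real (length (s @ t)) \<le> real n"
    using qD room' D0 lt by (simp add: m_def)
  then have "s @ t \<in> prefixes"
    using s x t(1) by (auto simp: prefixes_def)
  moreover have "real (msgs (s @ t)) \<ge> real (msgs s) + \<delta> * real k / 8"
    using t(3) q by linarith
  \<comment> \<open>Since \<open>Suc q\<close> is at most \<open>k\<close>, no more than
    \<open>D\<close> copies are added. Rounding up \<open>e\<close> costs at most one copy per site,
    whence the excess \<open>k\<close> over the fraction \<phi>.\<close>
  moreover have "real (occurrences x (s @ t)) \<le> \<phi> * real (length (s @ t)) + real k"
  proof -
    have "(1 - \<phi>) * real (length t) \<le> (1 - \<phi>) * D"
      unfolding lt using \<phi> qD by (intro mult_left_mono) auto
    with D3 show ?thesis by (simp add: occ m_def c_def algebra_simps)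
  qed
  ultimately show ?thesis using t(1) by blast
qed

section \<open>One cycle: raising all items, then diluting them by fillers\<close>

lemma length_eq_sum_occurrences:
  assumes "fst ` set s \<subseteq> {1..Suc L}"
  shows "length s = occurrences (Suc L) s + (\<Sum>i=1..L. occurrences i s)"
proof -
  have "length s = size (image_mset fst (mset s))" by simp
  also have "\<dots> = (\<Sum>i=1..Suc L. occurrences i s)"
    unfolding size_multiset_overloaded_eq using assms
    by (intro sum.mono_neutral_left) (auto simp: count_eq_zero_iff)
  finally show ?thesis by simp
qed

text \<open>The \<open>L\<close> items together fill at most a fraction 1 - \<delta>, apart from the
  excesses, whose sum Lk is at most L\<epsilon>F \<le> F for \<open>F\<close> fillers. Thus \<delta>
  times the length is at most 2F.\<close>

lemma length_le_fillers:
  assumes "fst ` set s \<subseteq> {1..Suc L}"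
    and "\<forall>i\<in>{1..L}. real (occurrences i s) \<le> \<phi> * real (length s) + real k"
    and large: "\<epsilon> * real (occurrences (Suc L) s) \<ge> real k"
  shows "real (length s) \<le> 2 * real (occurrences (Suc L) s) / \<delta>"
proof -
  let ?F = "real (occurrences (Suc L) s)"
  have "(\<Sum>i=1..L. real (occurrences i s)) \<le> real L * (\<phi> * real (length s) + real k)"
    using sum_bounded_above[of "{1..L}" "\<lambda>i. real (occurrences i s)"] assms(2) by auto
  then have "real (length s) \<le> ?F + \<phi> * real L * real (length s) + real L * real k"
    using length_eq_sum_occurrences[OF assms(1)] by (simp add: algebra_simps)
  also have "\<phi> * real L * real (length s) \<le> (1 - \<delta>) * real (length s)"
    using \<delta> by (intro mult_right_mono) auto
  also have "real L * real k \<le> real L * (\<epsilon> * ?F)"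
    using large by (intro mult_left_mono) auto
  also have "\<dots> = \<epsilon> * real L * ?F" by simp
  also have "\<dots> \<le> 1 * ?F"
  proof (intro mult_right_mono)
    have "\<epsilon> * real L \<le> \<phi> * real L" using \<epsilon> by (intro mult_right_mono) auto
    then show "\<epsilon> * real L \<le> 1" using \<delta> by linarith
  qed auto
  finally have "\<delta> * real (length s) \<le> 2 * ?F" by (simp add: algebra_simps)
  then show ?thesis using \<delta> by (simp add: field_simps)
qed

text \<open>The items are raised one after the other. Those still to come remain low, because their
  counts stay fixed while the length grows. The room is measured by the number of fillers, which
  does not change during this phase, and \<open>length_le_fillers\<close> translates it into a bound
  on the length.\<close>

lemma raise_items:
  assumes s: "s \<in> prefixes" "fst ` set s \<subseteq> {1..Suc L}"
    and room: "6 * real (occurrences (Suc L) s) / \<delta>\<^sup>2 \<le> real n"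
    and large: "\<epsilon> * real (occurrences (Suc L) s) \<ge> real k"
    and low: "\<forall>i\<in>{1..L}. real (occurrences i s) \<le> (\<phi> - 2 * \<epsilon>) * real (length s)"
    and "l \<le> L"
  shows "\<exists>t. fst ` set t \<subseteq> {1..l} \<and> s @ t \<in> prefixes \<and>
    real (msgs (s @ t)) \<ge> real (msgs s) + real l * (\<delta> * real k / 8) \<and>
    (\<forall>i\<in>{1..L}. real (occurrences i (s @ t)) \<le> \<phi> * real (length (s @ t)) + real k)"
  using \<open>l \<le> L\<close>
proof (induction l)
  case 0
  have "(\<phi> - 2 * \<epsilon>) * real (length s) \<le> \<phi> * real (length s) + real k"
    using \<epsilon> by (simp add: algebra_simps)
  with low s show ?case by (intro exI[of _ "[]"]) force
next
  case (Suc l)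
  then obtain t where t: "fst ` set t \<subseteq> {1..l}" "s @ t \<in> prefixes"
    "real (msgs (s @ t)) \<ge> real (msgs s) + real l * (\<delta> * real k / 8)"
    "\<forall>i\<in>{1..L}. real (occurrences i (s @ t)) \<le> \<phi> * real (length (s @ t)) + real k"
    by auto
  have fst_st: "fst ` set (s @ t) \<subseteq> {1..Suc L}"
    using s(2) t(1) Suc.prems by fastforce
  have occ: "occurrences i (s @ t) = occurrences i s" if "i > l" for i
    using occurrences_eq_0[of i t] t(1) that by fastforce
  have F: "occurrences (Suc L) (s @ t) = occurrences (Suc L) s"
    using occ Suc.prems by simp
  have len: "real (length (s @ t)) \<le> 2 * real (occurrences (Suc L) s) / \<delta>"
    using length_le_fillers[OF fst_st t(4)] large F by simp
  \<comment> \<open>The room asked for by \<open>raise_item\<close> is 3/\<delta> times the length,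
    and the length is at most 2/\<delta> times the number of fillers; this is the origin of the
    factor 6 over \<delta> squared.\<close>
  have "3 * real (length (s @ t)) / \<delta> \<le> 3 * (2 * real (occurrences (Suc L) s) / \<delta>) / \<delta>"
    using len \<delta> by (intro divide_right_mono mult_left_mono) auto
  also have "\<dots> = 6 * real (occurrences (Suc L) s) / \<delta>\<^sup>2"
    by (simp add: power2_eq_square)
  finally have room': "3 * real (length (s @ t)) / \<delta> \<le> real n" using room by simp
  have "\<epsilon> * real (occurrences (Suc L) s) \<le> \<epsilon> * real (length (s @ t))"
    using occurrences_le_length[where x = "Suc L" and t = "s @ t"] F \<epsilon> by (intro mult_left_mono) auto
  then have large': "\<epsilon> * real (length (s @ t)) \<ge> real k" using large by linarith
  have "(\<phi> - 2 * \<epsilon>) * real (length s) \<le> (\<phi> - 2 * \<epsilon>) * real (length (s @ t))"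
    using \<epsilon> by (intro mult_left_mono) auto
  moreover have "real (occurrences (Suc l) s) \<le> (\<phi> - 2 * \<epsilon>) * real (length s)"
    using low Suc.prems by simp
  ultimately have low': "real (occurrences (Suc l) (s @ t)) \<le> (\<phi> - 2 * \<epsilon>) * real (length (s @ t))"
    unfolding occ[OF lessI] by linarith
  have "Suc l \<in> {1..u}" using Suc.prems L by simp
  from raise_item[OF t(2) this room' large' low'] obtain t' where
    t': "set t' \<subseteq> {Suc l} \<times> {..<k}" "s @ t @ t' \<in> prefixes"
    "real (msgs (s @ t @ t')) \<ge> real (msgs (s @ t)) + \<delta> * real k / 8"
    "real (occurrences (Suc l) (s @ t @ t')) \<le> \<phi> * real (length (s @ t @ t')) + real k"
    by auto
  have "real (occurrences i (s @ t @ t')) \<le> \<phi> * real (length (s @ t @ t')) + real k"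
    if i: "i \<in> {1..L}" for i
  proof (cases "i = Suc l")
    case False
    have "occurrences i t' = 0" using t'(1) False by (intro occurrences_eq_0) auto
    moreover have "real (occurrences i (s @ t)) \<le> \<phi> * real (length (s @ t)) + real k"
      using t(4) i by blast
    moreover have "\<phi> * real (length (s @ t)) \<le> \<phi> * real (length (s @ t @ t'))"
      using \<epsilon> by (intro mult_left_mono) auto
    ultimately show ?thesis by simp
  qed (use t'(4) in simp)
  moreover have "fst ` set (t @ t') \<subseteq> {1..Suc l}" using t(1) t'(1) by fastforce
  moreover have "real (msgs (s @ t @ t')) \<ge> real (msgs s) + real (Suc l) * (\<delta> * real k / 8)"
    using t(3) t'(3) by (simp add: algebra_simps add_divide_distrib)
  ultimately show ?case using t'(2) by (intro exI[of _ "t @ t'"]) blast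
qed

text \<open>About \<epsilon>T/\<phi> fillers, up to a constant, suffice to dilute items from the
  fraction \<phi> to \<phi> - 2\<epsilon> in an input of length \<open>T\<close>. Since
  \<open>T\<close> is at most 2/\<delta> times the number of fillers, that number grows by a factor
  1 + O(\<epsilon>/(\<phi>\<delta>)) only.\<close>

lemma one_cycle:
  assumes s: "s \<in> prefixes" "fst ` set s \<subseteq> {1..Suc L}"
    and room: "6 * real (occurrences (Suc L) s) / \<delta>\<^sup>2 \<le> real n"
    and large: "\<epsilon> * real (occurrences (Suc L) s) \<ge> real k"
    and low: "\<forall>i\<in>{1..L}. real (occurrences i s) \<le> (\<phi> - 2 * \<epsilon>) * real (length s)"
  shows "\<exists>s'. s' \<in> prefixes \<and> fst ` set s' \<subseteq> {1..Suc L} \<and>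
    real (msgs s') \<ge> real (msgs s) + real L * (\<delta> * real k / 8) \<and>
    occurrences (Suc L) s' \<ge> occurrences (Suc L) s \<and>
    real (occurrences (Suc L) s') \<le> (1 + 20 * \<epsilon> / (\<phi> * \<delta>)) * real (occurrences (Suc L) s) \<and>
    (\<forall>i\<in>{1..L}. real (occurrences i s') \<le> (\<phi> - 2 * \<epsilon>) * real (length s'))"
proof -
  from raise_items[OF s room large low order.refl] obtain t where
    t: "fst ` set t \<subseteq> {1..L}" "s @ t \<in> prefixes"
    "real (msgs (s @ t)) \<ge> real (msgs s) + real L * (\<delta> * real k / 8)"
    "\<forall>i\<in>{1..L}. real (occurrences i (s @ t)) \<le> \<phi> * real (length (s @ t)) + real k"
    by blast
  define T F where "T = real (length (s @ t))" and "F = real (occurrences (Suc L) s)"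
  have fst_st: "fst ` set (s @ t) \<subseteq> {1..Suc L}"
    using s(2) t(1) by fastforce
  have F: "occurrences (Suc L) (s @ t) = occurrences (Suc L) s"
    using occurrences_eq_0[of "Suc L" t] t(1) by fastforce
  have T: "T \<le> 2 * F / \<delta>"
    using length_le_fillers[OF fst_st t(4)] large F by (simp add: T_def F_def)
  have "F \<le> T" using occurrences_le_length[where x = "Suc L" and t = "s @ t"] F by (simp add: T_def F_def)
  then have "\<epsilon> * F \<le> \<epsilon> * T" using \<epsilon> by (intro mult_left_mono) auto
  then have \<epsilon>T: "\<epsilon> * T \<ge> real k" using large by (simp add: F_def)
  \<comment> \<open>The solution of \<phi>T + k = (\<phi> - 2\<epsilon>)(T + y): with
    \<open>y\<close> fillers even an item of the largest possible count is low again. The bounds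
    \<phi> - 2\<epsilon> \<ge> \<phi>/3 and k \<le> \<epsilon>T give y \<le> 9\<epsilon>T/\<phi>,
    and rounding up turns 9 into 10.\<close>
  define y where "y = (2 * \<epsilon> * T + real k) / (\<phi> - 2 * \<epsilon>)"
  define p where "p = nat \<lceil>y\<rceil>"
  have y0: "y \<ge> 0" unfolding y_def using \<epsilon> by (intro divide_nonneg_pos) (auto simp: T_def)
  then have p: "real p \<ge> y" "real p \<le> y + 1" unfolding p_def by linarith+
  have "y \<le> 3 * \<epsilon> * T / (\<phi> / 3)"
    unfolding y_def using \<epsilon> \<epsilon>T order_trans[OF of_nat_0_le_iff \<epsilon>T]
    by (intro frac_le) (simp_all add: mult.commute)
  also have "\<dots> = 9 * (\<epsilon> * T / \<phi>)" by simp
  finally have "y \<le> 9 * (\<epsilon> * T / \<phi>)" .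
  moreover have "1 \<le> \<epsilon> * T / \<phi>" using \<epsilon> \<delta> \<epsilon>T k by (simp add: field_simps)
  ultimately have "real p \<le> 10 * (\<epsilon> * T / \<phi>)" using p(2) by linarith
  then have p10: "real p \<le> 10 * \<epsilon> * T / \<phi>" by (simp add: mult.assoc)
  also have "\<dots> \<le> 10 * \<epsilon> * (2 * F / \<delta>) / \<phi>"
    using T \<epsilon> by (intro divide_right_mono mult_left_mono) auto
  finally have growth: "real p \<le> 20 * \<epsilon> / (\<phi> * \<delta>) * F" by (simp add: field_simps)
  define s' where "s' = s @ t @ replicate p (Suc L, 0)"
  \<comment> \<open>The new fillers must fit into the \<open>n\<close> items too. By \<epsilon> <
    \<phi>/3 they at most add 10/3 of the length, and \<delta> \<le> 1/2 absorbs the constant 26/3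
    into the room already available.\<close>
  have "10 * \<epsilon> * T / \<phi> = (10 * \<epsilon> / \<phi>) * T" by simp
  also have "\<dots> \<le> (10 / 3) * T"
    using \<epsilon> by (intro mult_right_mono) (auto simp: T_def field_simps)
  finally have "T + real p \<le> (13 / 3) * T" using p10 by simp
  also have "\<dots> \<le> (13 / 3) * (2 * F / \<delta>)" using T by simp
  also have "\<dots> \<le> 6 * F / \<delta>\<^sup>2"
  proof -
    have "26 * \<delta> * F \<le> 18 * F" using \<delta> by (intro mult_right_mono) (auto simp: F_def)
    then show ?thesis using \<delta> by (simp add: field_simps power2_eq_square)
  qed
  finally have "length s' \<le> n" using room by (simp add: T_def F_def s'_def)
  then have pre: "s' \<in> prefixes"
    using t(2) L k by (auto simp: prefixes_def s'_def)
  have occ: "real (occurrences (Suc L) s') = F + real p"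
    using F by (simp add: s'_def F_def)
  have "real (occurrences i s') \<le> (\<phi> - 2 * \<epsilon>) * real (length s')" if i: "i \<in> {1..L}" for i
  proof -
    have "real (occurrences i s') = real (occurrences i (s @ t))"
      using i by (simp add: s'_def)
    also have "\<dots> \<le> \<phi> * T + real k" using t(4) i by (simp add: T_def)
    also have "\<dots> = (\<phi> - 2 * \<epsilon>) * (T + y)" using \<epsilon> by (simp add: y_def field_simps)
    also have "\<dots> \<le> (\<phi> - 2 * \<epsilon>) * (T + real p)" using \<epsilon> p by (intro mult_left_mono) auto
    finally show ?thesis by (simp add: s'_def T_def add.assoc split: if_splits)
  qed
  moreover have "msgs (s @ t) \<le> msgs s'"
    using msgs_mono[of "s @ t"] pre by (simp add: s'_def)
  moreover have "fst ` set s' \<subseteq> {1..Suc L}" using fst_st by (auto simp: s'_def)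
  ultimately show ?thesis using pre t(3) occ growth
    by (intro exI[of _ s']) (auto simp: F_def algebra_simps)
qed

section \<open>Iterating the cycle\<close>

lemma many_cycles:
  assumes "6 * (real F * (1 + 20 * \<epsilon> / (\<phi> * \<delta>)) ^ N) / \<delta>\<^sup>2 \<le> real n"
    and large: "\<epsilon> * real F \<ge> real k"
  shows "\<exists>s. s \<in> prefixes \<and> fst ` set s \<subseteq> {1..Suc L} \<and>
    real (msgs s) \<ge> real N * (real L * (\<delta> * real k / 8)) \<and>
    occurrences (Suc L) s \<ge> F \<and>
    real (occurrences (Suc L) s) \<le> real F * (1 + 20 * \<epsilon> / (\<phi> * \<delta>)) ^ N \<and>
    (\<forall>i\<in>{1..L}. real (occurrences i s) \<le> (\<phi> - 2 * \<epsilon>) * real (length s))"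
  using assms(1)
proof (induction N)
  case 0
  \<comment> \<open>The adversary starts with fillers alone, so that all \<open>L\<close> items have
    count 0 and are low.\<close>
  let ?s = "replicate F (Suc L, 0) :: (item \<times> site) list"
  have "1 * \<delta>\<^sup>2 \<le> 6" using \<delta> power_le_one[of \<delta> 2] by simp
  then have "real F * \<delta>\<^sup>2 \<le> real F * 6" by (intro mult_left_mono) auto
  then have "real F \<le> 6 * real F / \<delta>\<^sup>2" using \<delta> by (simp add: field_simps)
  then have "F \<le> n" using 0 by simp
  then show ?case using \<epsilon> L k
    by (intro exI[of _ ?s]) (auto simp: prefixes_def)
next
  case (Suc N)
  define \<kappa> where "\<kappa> = 20 * \<epsilon> / (\<phi> * \<delta>)"
  have "\<kappa> \<ge> 0" using \<epsilon> \<delta> by (simp add: \<kappa>_def)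
  then have "6 * (real F * (1 + \<kappa>) ^ N) / \<delta>\<^sup>2 \<le> 6 * (real F * (1 + \<kappa>) ^ Suc N) / \<delta>\<^sup>2"
    by (intro divide_right_mono mult_left_mono power_increasing) auto
  with Suc.prems have room: "6 * (real F * (1 + \<kappa>) ^ N) / \<delta>\<^sup>2 \<le> real n"
    by (simp add: \<kappa>_def)
  with Suc.IH obtain s where s: "s \<in> prefixes" "fst ` set s \<subseteq> {1..Suc L}"
    "real (msgs s) \<ge> real N * (real L * (\<delta> * real k / 8))"
    "occurrences (Suc L) s \<ge> F"
    "real (occurrences (Suc L) s) \<le> real F * (1 + \<kappa>) ^ N"
    "\<forall>i\<in>{1..L}. real (occurrences i s) \<le> (\<phi> - 2 * \<epsilon>) * real (length s)"
    unfolding \<kappa>_def by blast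
  have "6 * real (occurrences (Suc L) s) / \<delta>\<^sup>2 \<le> 6 * (real F * (1 + \<kappa>) ^ N) / \<delta>\<^sup>2"
    using s(5) by (intro divide_right_mono mult_left_mono) auto
  with room have room': "6 * real (occurrences (Suc L) s) / \<delta>\<^sup>2 \<le> real n" by linarith
  have "\<epsilon> * real F \<le> \<epsilon> * real (occurrences (Suc L) s)"
    using \<epsilon> by (intro mult_left_mono of_nat_mono s(4)) simp
  with large have large': "\<epsilon> * real (occurrences (Suc L) s) \<ge> real k" by linarith
  from one_cycle[OF s(1,2) room' large' s(6)] obtain s' where
    s': "s' \<in> prefixes" "fst ` set s' \<subseteq> {1..Suc L}"
    "real (msgs s') \<ge> real (msgs s) + real L * (\<delta> * real k / 8)"
    "occurrences (Suc L) s' \<ge> occurrences (Suc L) s"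
    "real (occurrences (Suc L) s') \<le> (1 + \<kappa>) * real (occurrences (Suc L) s)"
    "\<forall>i\<in>{1..L}. real (occurrences i s') \<le> (\<phi> - 2 * \<epsilon>) * real (length s')"
    unfolding \<kappa>_def by blast
  have "(1 + \<kappa>) * real (occurrences (Suc L) s) \<le> (1 + \<kappa>) * (real F * (1 + \<kappa>) ^ N)"
    using s(5) \<open>\<kappa> \<ge> 0\<close> by (intro mult_left_mono) auto
  with s'(5) have "real (occurrences (Suc L) s') \<le> real F * (1 + \<kappa>) ^ Suc N"
    by (simp add: mult_ac)
  moreover have "real (msgs s') \<ge> real (Suc N) * (real L * (\<delta> * real k / 8))"
    using s(3) s'(3) by (simp add: algebra_simps)
  moreover have "occurrences (Suc L) s' \<ge> F" using s(4) s'(4) by linarith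
  ultimately show ?case using s'(1,2,6) unfolding \<kappa>_def by blast
qed

text \<open>The sequence of the adversary is padded to \<open>n\<close> items, which cannot shorten
  the transcript.\<close>

lemma costly_input:
  assumes "6 * (real F * (1 + 20 * \<epsilon> / (\<phi> * \<delta>)) ^ N) / \<delta>\<^sup>2 \<le> real n"
    and "\<epsilon> * real F \<ge> real k"
  shows "\<exists>as\<in>inputs k u n. \<exists>\<sigma> H. run P k as (\<sigma>, H) \<and>
    real (cost w H) \<ge> real N * (real L * (\<delta> * real k / 8))"
proof -
  from many_cycles[OF assms] obtain s where
    s: "s \<in> prefixes" "real (msgs s) \<ge> real N * (real L * (\<delta> * real k / 8))"
    by blast
  define as where "as = s @ replicate (n - length s) (u, 0)"
  have as: "as \<in> inputs k u n" using pad_in_inputs[OF s(1)] by (simp add: as_def)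
  then have pre: "as \<in> prefixes" by (auto simp: inputs_def prefixes_def)
  obtain \<sigma> H where C: "conf as = (\<sigma>, H)" by fastforce
  with run_conf[OF pre] have "run P k as (\<sigma>, H)" by simp
  moreover have "msgs s \<le> length H"
    using msgs_mono[of s "replicate (n - length s) (u, 0)"] pre C
    by (simp add: as_def msgs_def)
  then have "real (cost w H) \<ge> real N * (real L * (\<delta> * real k / 8))"
    using s(2) length_le_cost[of H w] by linarith
  ultimately show ?thesis using as by blast
qed

end

section \<open>Number of cycles and choice of parameters\<close>

text \<open>For \<open>N\<close> equal to ln n / (2\<kappa>) rounded up, 1 + \<kappa> \<le> exp
  \<kappa> bounds the power by exp \<kappa> times the square root of n. This is at most n/K once ln
  n \<ge> 2(ln K + \<kappa>); the factor 2 thus pays for the constants.\<close>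

lemma eventually_many_powers:
  fixes K \<kappa> :: real
  assumes "K > 0" "\<kappa> > 0"
  shows "\<forall>\<^sub>F n in sequentially. \<exists>N. K * (1 + \<kappa>) ^ N \<le> real n \<and> real N \<ge> ln (real n) / (2 * \<kappa>)"
proof -
  have "filterlim (\<lambda>n. ln (real n)) at_top sequentially"
    by (rule filterlim_compose[OF ln_at_top filterlim_real_sequentially])
  then have "\<forall>\<^sub>F n in sequentially. ln (real n) \<ge> max 0 (2 * (ln K + \<kappa>))"
    by (rule filterlim_at_top[THEN iffD1, rule_format])
  with eventually_gt_at_top[of 0] show ?thesis
  proof eventually_elim
    case (elim n)
    define N where "N = nat \<lceil>ln (real n) / (2 * \<kappa>)\<rceil>"
    have "ln (real n) / (2 * \<kappa>) \<ge> 0" using elim assms by simp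
    then have N: "real N \<ge> ln (real n) / (2 * \<kappa>)" "real N \<le> ln (real n) / (2 * \<kappa>) + 1"
      unfolding N_def by linarith+
    have "(1 + \<kappa>) ^ N \<le> exp \<kappa> ^ N" using assms by (intro power_mono) auto
    also have "\<dots> = exp (real N * \<kappa>)" by (simp add: exp_of_nat_mult)
    also have "real N * \<kappa> \<le> (ln (real n) / (2 * \<kappa>) + 1) * \<kappa>"
      using N(2) assms by (intro mult_right_mono) auto
    also have "\<dots> = ln (real n) / 2 + \<kappa>" using assms by (simp add: distrib_right)
    also have "\<dots> \<le> ln (real n) - ln K" using elim by simp
    also have "exp \<dots> = real n / K" using elim assms by (simp add: exp_diff)
    finally have "K * (1 + \<kappa>) ^ N \<le> real n"
      using assms by (simp add: field_simps)
    with N show ?case by blast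
  qed
qed

text \<open>The constant depends on \<open>phi_max\<close> alone, whereas the threshold for
  \<open>n\<close> may also depend on \<epsilon>, \<phi> and \<open>k\<close>, but not on the
  universe, the word size or the protocol. Some bound on \<phi> is unavoidable: for \<phi> > 1 the
  empty answer is always correct. So is one on \<open>u\<close>: for \<phi> < 1 and a single item,
  the answer consisting of that item is always correct.\<close>

theorem theorem2:
  fixes phi_max :: real
  assumes "phi_max < 1"
  shows "\<exists>c>0. \<forall>(\<epsilon>::real) (\<phi>::real) (k::nat).
    \<epsilon> > 0 \<longrightarrow> \<phi> > 3 * \<epsilon> \<longrightarrow> \<phi> \<le> phi_max \<longrightarrow> k \<ge> 2 \<longrightarrow>
    (\<forall>\<^sub>F n in sequentially. \<forall>(u::nat) (w::nat) P.
       real u \<ge> 1 / \<phi> \<longrightarrow> w \<ge> 1 \<longrightarrow> tracks_heavy_hitters P k u \<epsilon> \<phi> n \<longrightarrow>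
       (\<exists>as\<in>inputs k u n. \<exists>\<sigma> H. run P k as (\<sigma>, H) \<and>
          real (cost w H) \<ge> c * (real k / \<epsilon> * ln (real n))))"
proof -
  define \<delta> where "\<delta> = min (1/2) (1 - phi_max)"
  have \<delta>: "\<delta> > 0" "\<delta> \<le> 1/2" "phi_max \<le> 1 - \<delta>" using assms by (auto simp: \<delta>_def min_def)
  show ?thesis
  \<comment> \<open>There are ln n / (2\<kappa>) cycles with \<kappa> =
    20\<epsilon>/(\<phi>\<delta>), at least 1/(4\<phi>) items per cycle and \<delta>k/8 messages per
    item; 1280 = 40 * 4 * 8.\<close>
  proof (intro exI[of _ "\<delta>\<^sup>2 / 1280"] conjI allI impI)
    show "\<delta>\<^sup>2 / 1280 > 0" using \<delta> by simp
  next
    fix \<epsilon> \<phi> :: real and k :: nat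
    assume *: "\<epsilon> > 0" "\<phi> > 3 * \<epsilon>" "\<phi> \<le> phi_max" "k \<ge> 2"
    define \<kappa> where "\<kappa> = 20 * \<epsilon> / (\<phi> * \<delta>)"
    define F where "F = nat \<lceil>real k / \<epsilon>\<rceil>"
    \<comment> \<open>At the fraction \<phi> each, the items fill at most half of the input. The
      maximum matters for \<phi> > 1/2, where a single item fills \<phi> \<le> 1 - \<delta>. In both
      cases \<open>L\<close> is at least 1/(4\<phi>) and less than 1/\<phi>, which leaves an item of
      the universe for the filler.\<close>
    define L where "L = max 1 (nat \<lfloor>1 / (2 * \<phi>)\<rfloor>)"
    have \<phi>: "0 < \<phi>" "\<phi> \<le> 1 - \<delta>" "\<phi> < 1" using * \<delta> by linarith+
    have "real k / \<epsilon> > 0" using * by simp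
    then have F: "real F \<ge> real k / \<epsilon>" "real F > 0" unfolding F_def by linarith+
    then have large: "\<epsilon> * real F \<ge> real k" using * by (simp add: field_simps)
    have \<kappa>: "\<kappa> > 0" using * \<phi> \<delta> by (simp add: \<kappa>_def)
    have L: "\<phi> * real L \<le> 1 - \<delta>" "4 * \<phi> * real L \<ge> 1" "real L < 1 / \<phi>"
    proof -
      define z where "z = 1 / (2 * \<phi>)"
      have z: "z > 0" "\<phi> * z = 1 / 2" "1 / \<phi> = 2 * z" using \<phi> by (auto simp: z_def)
      show "\<phi> * real L \<le> 1 - \<delta>"
      proof (cases "z < 1")
        case True
        then have "L = 1" unfolding L_def z_def[symmetric] using z by linarith
        then show ?thesis using \<phi> by simp
      next
        case False
        then have "real L \<le> z" unfolding L_def z_def[symmetric] by linarith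
        then have "\<phi> * real L \<le> \<phi> * z" using \<phi> by (intro mult_left_mono) auto
        then show ?thesis using z \<delta> by simp
      qed
      have "2 * real L \<ge> z" unfolding L_def z_def[symmetric] using z by linarith
      then have "\<phi> * (2 * real L) \<ge> \<phi> * z" using \<phi> by (intro mult_left_mono) auto
      then show "4 * \<phi> * real L \<ge> 1" using z by simp
      have "1 < 2 * z" using \<phi> z(3) by (metis less_divide_eq_1_pos)
      then show "real L < 1 / \<phi>" unfolding z(3) L_def z_def[symmetric] using z by linarith
    qed
    have "6 * real F / \<delta>\<^sup>2 > 0" using F \<delta> by simp
    from eventually_many_powers[OF this \<kappa>] eventually_gt_at_top[of 0]
    show "\<forall>\<^sub>F n in sequentially. \<forall>u w P.
       real u \<ge> 1 / \<phi> \<longrightarrow> w \<ge> 1 \<longrightarrow> tracks_heavy_hitters P k u \<epsilon> \<phi> n \<longrightarrow>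
       (\<exists>as\<in>inputs k u n. \<exists>\<sigma> H. run P k as (\<sigma>, H) \<and>
          real (cost w H) \<ge> \<delta>\<^sup>2 / 1280 * (real k / \<epsilon> * ln (real n)))"
    proof eventually_elim
      case (elim n)
      from elim(1) obtain N where N: "6 * real F / \<delta>\<^sup>2 * (1 + \<kappa>) ^ N \<le> real n"
        "real N \<ge> ln (real n) / (2 * \<kappa>)" by blast
      have ln0: "ln (real n) \<ge> 0" using elim(2) by simp
      have bound: "\<delta>\<^sup>2 / 1280 * (real k / \<epsilon> * ln (real n)) \<le> real N * (real L * (\<delta> * real k / 8))"
      proof -
        have "\<delta>\<^sup>2 / 1280 * (real k / \<epsilon> * ln (real n)) =
            ln (real n) / (2 * \<kappa>) * (1 / (4 * \<phi>) * (\<delta> * real k / 8))"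
          using * \<phi> \<delta> by (simp add: \<kappa>_def field_simps power2_eq_square)
        also have "\<dots> \<le> real N * (real L * (\<delta> * real k / 8))"
        proof (intro mult_mono mult_right_mono)
          show "1 / (4 * \<phi>) \<le> real L" using L \<phi> by (simp add: field_simps)
        qed (use N ln0 \<kappa> \<phi> \<delta> in auto)
        finally show ?thesis .
      qed
      show ?case
      proof (intro allI impI)
        fix u w :: nat and P
        assume u: "real u \<ge> 1 / \<phi>" and "w \<ge> 1" and tracks: "tracks_heavy_hitters P k u \<epsilon> \<phi> n"
        have "L < u" using u L by linarith
        then interpret heavy_hitter_tracker P k u n L \<epsilon> \<phi> \<delta>
          using tracks * \<phi> \<delta> L by unfold_locales auto
        have "6 * (real F * (1 + 20 * \<epsilon> / (\<phi> * \<delta>)) ^ N) / \<delta>\<^sup>2 \<le> real n"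
          using N(1) by (simp add: \<kappa>_def)
        from costly_input[OF this large, of w] bound
        show "\<exists>as\<in>inputs k u n. \<exists>\<sigma> H. run P k as (\<sigma>, H) \<and>
          real (cost w H) \<ge> \<delta>\<^sup>2 / 1280 * (real k / \<epsilon> * ln (real n))"
          by (meson order_trans)
      qed
    qed
  qed
qed

end
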